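(* Let $d\geq 2$ and $n\geq d+1$ be integers with $n$ divisible by $d+1$. Let $T(n,d+1)$ be the complete balanced $(d+1)$-partite graph with parts $V_1,\ldots,V_{d+1}$, each of size $n/(d+1)$, and let $q^{\triangle}:V(T(n,d+1))\to\mathbb{R}^d$ map all vertices of $V_i$ to the $i$-th vertex of a regular $d$-dimensional simplex in $\mathbb{R}^d$ (distinct parts going to distinct simplex vertices). Then the spectrum of $L(T(n,d+1),q^{\triangle})$ is \[ \left\{0^{(d(d+1)/2)},\;\left(\tfrac{n}{2(d+1)}\right)^{((n-d-1)(d-1))},\;\left(\tfrac{n}{d+1}\right)^{((d-2)(d+1)/2)},\;\left(\tfrac{n}{2}\right)^{(n-1)},\;n^{(1)}\right\}, \] where the superscript $(m)$ indicates multiplicity $m$.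
   Context: For a graph $G=(V,E)$ and a map $p:V\to\mathbb{R}^d$, for distinct $u,v\in V$ let $d_{uv}=\frac{p(u)-p(v)}{\|p(u)-p(v)\|}$ if $p(u)\neq p(v)$ and $d_{uv}=0$ otherwise. The normalized rigidity matrix $R(G,p)$ is the $d|V|\times|E|$ real matrix whose column indexed by the edge $\{u,v\}$ is $(1_u-1_v)\otimes d_{uv}$, where $\{1_u\}$ is the standard basis of $\mathbb{R}^{|V|}$ and $\otimes$ is the Kronecker product. The stiffness matrix is $L(G,p)=R(G,p)R(G,p)^t$. The complete balanced $r$-partite graph $T(n,r)$ has vertex set $V_1\cup\cdots\cup V_r$ (disjoint, each of size $n/r$) and edges all pairs $\{u,v\}$ with $u\in V_i$, $v\in V_j$, $i\neq j$. *)

theory Defs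
  imports
    "Jordan_Normal_Form.Char_Poly"
    "HOL-Library.Disjoint_Sets"
    "HOL-Library.Multiset"
    "HOL-Computational_Algebra.Computational_Algebra"
begin

text \<open>Points of \<open>\<real>\<^sup>d\<close> are elements of \<^term>\<open>carrier_vec d :: real vec set\<close>.\<close>

definition vec_len :: "real vec \<Rightarrow> real" where
  "vec_len x = sqrt (x \<bullet> x)"

definition edge_dir :: "nat \<Rightarrow> ('v \<Rightarrow> real vec) \<Rightarrow> 'v \<Rightarrow> 'v \<Rightarrow> real vec" where
  "edge_dir d p u v =
     (if p u \<noteq> p v then (1 / vec_len (p u - p v)) \<cdot>\<^sub>v (p u - p v) else 0\<^sub>v d)"

definition kronecker_vec :: "'a::times vec \<Rightarrow> 'a vec \<Rightarrow> 'a vec" where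
  "kronecker_vec x y =
     vec (dim_vec x * dim_vec y) (\<lambda>k. x $ (k div dim_vec y) * y $ (k mod dim_vec y))"

text \<open>A graph on the finite vertex set \<open>V\<close> has as edge set \<open>E\<close> a set of two-element subsets
  of \<open>V\<close>. Matrices are indexed by natural numbers, so they refer to an enumeration \<open>vs\<close> of \<open>V\<close>
  and an enumeration \<open>es\<close> of \<open>E\<close>. Each edge is listed once, as a pair in one of its two
  orientations; by \<open>rigidity_column_commute\<close> below, the orientation is immaterial.\<close>

definition enumerates_graph ::
  "'v set \<Rightarrow> 'v set set \<Rightarrow> 'v list \<Rightarrow> ('v \<times> 'v) list \<Rightarrow> bool" where
  "enumerates_graph V E vs es \<longleftrightarrow>
     distinct vs \<and> set vs = V \<and>
     distinct (map (\<lambda>(u, v). {u, v}) es) \<and> set (map (\<lambda>(u, v). {u, v}) es) = E"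

definition vertex_basis_vec :: "'v list \<Rightarrow> 'v \<Rightarrow> real vec" where
  "vertex_basis_vec vs u = vec (length vs) (\<lambda>i. if vs ! i = u then 1 else 0)"

definition rigidity_column ::
  "nat \<Rightarrow> 'v list \<Rightarrow> ('v \<Rightarrow> real vec) \<Rightarrow> 'v \<Rightarrow> 'v \<Rightarrow> real vec" where
  "rigidity_column d vs p u v =
     kronecker_vec (vertex_basis_vec vs u - vertex_basis_vec vs v) (edge_dir d p u v)"

lemma edge_dir_commute:
  assumes "p u \<in> carrier_vec d" "p v \<in> carrier_vec d"
  shows "edge_dir d p v u = - edge_dir d p u v"
proof -
  have "p v - p u = - (p u - p v)"
    using assms by (intro eq_vecI) auto
  moreover have "vec_len (p v - p u) = vec_len (p u - p v)"
    using assms unfolding vec_len_def scalar_prod_def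
    by (auto intro!: sum.cong simp: algebra_simps)
  ultimately show ?thesis
    unfolding edge_dir_def by (intro eq_vecI) (auto simp: diff_divide_distrib)
qed

lemma rigidity_column_commute:
  assumes "p u \<in> carrier_vec d" "p v \<in> carrier_vec d"
  shows "rigidity_column d vs p v u = rigidity_column d vs p u v"
proof (intro eq_vecI)
  fix k assume "k < dim_vec (rigidity_column d vs p u v)"
  moreover have dim: "dim_vec (edge_dir d p u v) = d"
    using assms by (auto simp: edge_dir_def)
  ultimately have "k < length vs * d"
    by (simp add: rigidity_column_def kronecker_vec_def vertex_basis_vec_def)
  then have "k div d < length vs" "k mod d < d"
    by (cases "d = 0"; simp add: less_mult_imp_div_less)+
  then show "rigidity_column d vs p v u $ k = rigidity_column d vs p u v $ k"
    using \<open>k < length vs * d\<close> dim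
    by (simp add: rigidity_column_def kronecker_vec_def vertex_basis_vec_def
        edge_dir_commute[of p u d v, OF assms])
qed (simp add: rigidity_column_def kronecker_vec_def vertex_basis_vec_def
    edge_dir_commute[of p u d v, OF assms])

definition rigidity_matrix ::
  "nat \<Rightarrow> 'v list \<Rightarrow> ('v \<times> 'v) list \<Rightarrow> ('v \<Rightarrow> real vec) \<Rightarrow> real mat" where
  "rigidity_matrix d vs es p =
     mat_of_cols (d * length vs) (map (\<lambda>(u, v). rigidity_column d vs p u v) es)"

definition stiffness_matrix ::
  "nat \<Rightarrow> 'v list \<Rightarrow> ('v \<times> 'v) list \<Rightarrow> ('v \<Rightarrow> real vec) \<Rightarrow> real mat" where
  "stiffness_matrix d vs es p =
     rigidity_matrix d vs es p * transpose_mat (rigidity_matrix d vs es p)"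

text \<open>The spectrum as a multiset: every real eigenvalue with its algebraic multiplicity.\<close>

definition spectrum_mset :: "real mat \<Rightarrow> real multiset" where
  "spectrum_mset A = proots (char_poly A)"

text \<open>\<open>(V, E)\<close> is the complete balanced \<open>r\<close>-partite graph on \<open>n\<close> vertices, with parts
  \<open>P 0, \<dots>, P (r - 1)\<close>. The definition is meant for \<open>r\<close> dividing \<open>n\<close>.\<close>

definition complete_balanced_multipartite ::
  "nat \<Rightarrow> nat \<Rightarrow> (nat \<Rightarrow> 'v set) \<Rightarrow> 'v set \<Rightarrow> 'v set set \<Rightarrow> bool" where
  "complete_balanced_multipartite n r P V E \<longleftrightarrow>
     disjoint_family_on P {..<r} \<and>
     (\<forall>i<r. finite (P i) \<and> card (P i) = n div r) \<and>
     V = (\<Union>i<r. P i) \<and>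
     E = {{u, v} | u v i j. i < r \<and> j < r \<and> i \<noteq> j \<and> u \<in> P i \<and> v \<in> P j}"

text \<open>\<open>s 0, \<dots>, s d\<close> are the vertices of a regular \<open>d\<close>-simplex in \<open>\<real>\<^sup>d\<close>: they are affinely
  independent, and all edges of the simplex have the same length.\<close>

definition regular_simplex :: "nat \<Rightarrow> (nat \<Rightarrow> real vec) \<Rightarrow> bool" where
  "regular_simplex d s \<longleftrightarrow>
     (\<forall>i\<le>d. s i \<in> carrier_vec d) \<and>
     (\<forall>c :: nat \<Rightarrow> real. (\<Sum>i\<le>d. c i) = 0 \<and> (\<forall>k<d. (\<Sum>i\<le>d. c i * s i $ k) = 0)
        \<longrightarrow> (\<forall>i\<le>d. c i = 0)) \<and>
     (\<exists>a. \<forall>i\<le>d. \<forall>j\<le>d. i \<noteq> j \<longrightarrow> vec_len (s i - s j) = a)"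

end

theory Submission
  imports Defs
begin

text \<open>
  A real eigenvalue has algebraic multiplicity at least its geometric one, and the multiplicities
  in the theorem add up to \<open>d n\<close>, so it suffices to exhibit enough independent eigenvectors for
  each of the five values. A vector at a vertex of part \<open>i\<close> is written in the basis of the \<open>d\<close>
  unit directions from the \<open>i\<close>-th simplex vertex to the others. Any two of these have inner product
  \<open>1/2\<close>, so in these coordinates \<open>g u j\<close> (\<open>u\<close> a vertex, \<open>j\<close> another part) the stiffness
  operator is purely combinatorial. With \<open>m\<close> the size of the parts, eigenvectors are:
  \<^item> for \<open>m / 2\<close>: \<open>g\<close> with vanishing sums over each part and over the directions at each vertex;
  \<^item> for \<open>m (d + 1) / 2\<close>: \<open>g u j = h u + avg j h\<close>, where \<open>h\<close> has sum zero and \<open>avg j\<close> is the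
    average over part \<open>j\<close>;
  \<^item> for \<open>m (d + 1)\<close>: \<open>g = 1\<close>;
  \<^item> for \<open>m\<close>: symmetric functions of the two parts with vanishing row sums;
  \<^item> for \<open>0\<close>: antisymmetric functions of the two parts, each corrected by \<open>1 / (d + 1)\<close> of its row sums.
\<close>

no_notation fps_nth (infixl "$" 75)

section \<open>Geometric and algebraic multiplicity of a real eigenvalue\<close>

text \<open>The block matrix \<open>?M\<close> becomes block triangular when multiplied on the right
  by \<open>?U\<close> or by \<open>?W\<close>; comparing determinants gives the identity. Keeping
  \<open>a ^ k\<close> as a factor avoids a division, so \<open>a = 0\<close> is covered.\<close>

lemma det_add_mult_eigen:
  fixes X :: "'a :: idom mat"
  assumes X: "X \<in> carrier_mat n n" and B: "B \<in> carrier_mat n k" and C: "C \<in> carrier_mat k n"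
    and CB: "C * B = 1\<^sub>m k" and XB: "X * B = a \<cdot>\<^sub>m B"
  shows "a ^ k * det (X + B * C) = (a + 1) ^ k * det X"
proof -
  let ?M = "four_block_mat X (- B) C (1\<^sub>m k)"
  let ?U = "four_block_mat (1\<^sub>m n) B (0\<^sub>m k n) (a \<cdot>\<^sub>m 1\<^sub>m k)"
  let ?W = "four_block_mat (1\<^sub>m n) (0\<^sub>m n k) (- C) (1\<^sub>m k)"
  have M: "?M \<in> carrier_mat (n + k) (n + k)"
    using X B C by auto
  have U: "?U \<in> carrier_mat (n + k) (n + k)" and W: "?W \<in> carrier_mat (n + k) (n + k)"
    using B C by auto
  have "X * B + - B * (a \<cdot>\<^sub>m 1\<^sub>m k) = 0\<^sub>m n k"
    unfolding XB using B by (intro eq_matI) auto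
  moreover have "C * B + 1\<^sub>m k * (a \<cdot>\<^sub>m 1\<^sub>m k) = (a + 1) \<cdot>\<^sub>m 1\<^sub>m k"
    unfolding CB by (intro eq_matI) auto
  ultimately have "?M * ?U = four_block_mat X (0\<^sub>m n k) C ((a + 1) \<cdot>\<^sub>m 1\<^sub>m k)"
    using X B C by (subst mult_four_block_mat[of _ n n _ k _ k]) auto
  then have "det (?M * ?U) = det X * (a + 1) ^ k"
    using X C by (simp add: det_four_block_mat_upper_right_zero[of _ n _ k])
  moreover have "det ?U = a ^ k"
    using B by (subst det_four_block_mat_lower_left_zero[of _ n _ k]) auto
  moreover have "X + - B * - C = X + B * C"
    using B C by (intro eq_matI) auto
  then have "?M * ?W = four_block_mat (X + B * C) (- B) (0\<^sub>m k n) (1\<^sub>m k)"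
    using X B C by (subst mult_four_block_mat[of _ n n _ k _ k]) auto
  then have "det (?M * ?W) = det (X + B * C)"
    using X B C by (simp add: det_four_block_mat_lower_left_zero[of _ n _ k])
  moreover have "det ?W = 1"
    using C by (subst det_four_block_mat_upper_right_zero[of _ n _ k]) auto
  ultimately show ?thesis
    using det_mult[OF M U] det_mult[OF M W] by (simp add: mult.commute)
qed

text \<open>The Gram matrix \<open>?G\<close> is nonsingular because its quadratic form at
  \<open>v\<close> is the squared length of \<open>B\<close> times \<open>v\<close>. Its inverse
  times the transpose of \<open>B\<close> is the left inverse.\<close>

lemma mat_left_inverse_exists:
  fixes B :: "real mat"
  assumes B: "B \<in> carrier_mat n k"
    and inj: "\<And>v. v \<in> carrier_vec k \<Longrightarrow> B *\<^sub>v v = 0\<^sub>v n \<Longrightarrow> v = 0\<^sub>v k"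
  obtains C where "C \<in> carrier_mat k n" "C * B = 1\<^sub>m k"
proof -
  let ?G = "transpose_mat B * B"
  have G: "?G \<in> carrier_mat k k"
    using B by auto
  have "det ?G \<noteq> 0"
  proof
    assume "det ?G = 0"
    then obtain v where v: "v \<in> carrier_vec k" "v \<noteq> 0\<^sub>v k" "?G *\<^sub>v v = 0\<^sub>v k"
      using det_0_iff_vec_prod_zero_field[OF G] by auto
    have Bv: "B *\<^sub>v v \<in> carrier_vec n"
      using B v by auto
    have "?G *\<^sub>v v = transpose_mat B *\<^sub>v (B *\<^sub>v v)"
      using B v by (intro assoc_mult_mat_vec[of _ k n _ k]) auto
    then have "(B *\<^sub>v v) \<bullet> (B *\<^sub>v v) = (?G *\<^sub>v v) \<bullet> v"
      using transpose_vec_mult_scalar[OF B v(1) Bv] by simp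
    also have "\<dots> = 0"
      using v by simp
    finally have "B *\<^sub>v v = 0\<^sub>v n"
      using conjugate_square_eq_0_vec[OF Bv] Bv by (simp add: scalar_prod_def)
    then show False
      using inj v by auto
  qed
  from det_non_zero_imp_unit[OF G this]
  obtain H where H: "H \<in> carrier_mat k k" "H * ?G = 1\<^sub>m k"
    unfolding Units_def by (auto simp: ring_mat_def)
  show thesis
    using that[of "H * transpose_mat B"] H B by (simp add: assoc_mult_mat[of _ k k _ n _ k])
qed

text \<open>Deflation: with the eigenvectors as columns of \<open>B\<close> and a left inverse
  \<open>C\<close>, passing from \<open>A\<close> to \<open>A - B * C\<close> moves their eigenvalue
  from \<open>l\<close> to \<open>l - 1\<close>. So \<open>card K\<close> factors
  \<open>[:-l, 1:]\<close> of the characteristic polynomial are exchanged for factors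
  \<open>[:1 - l, 1:]\<close>, which do not vanish at \<open>l\<close>.\<close>

lemma order_char_poly_ge_card:
  fixes A :: "real mat" and v :: "'k \<Rightarrow> real vec"
  assumes A: "A \<in> carrier_mat n n" and K: "finite K"
    and v: "\<And>k. k \<in> K \<Longrightarrow> v k \<in> carrier_vec n"
    and eigen: "\<And>k. k \<in> K \<Longrightarrow> A *\<^sub>v v k = l \<cdot>\<^sub>v v k"
    and indep: "\<And>c k. (\<And>i. i < n \<Longrightarrow> (\<Sum>k\<in>K. c k * v k $ i) = 0) \<Longrightarrow> k \<in> K \<Longrightarrow> c k = 0"
  shows "card K \<le> order l (char_poly A)"
proof -
  let ?k = "card K"
  obtain e where e: "bij_betw e {0..<?k} K"
    using ex_bij_betw_nat_finite[OF K] by auto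
  then have eK: "e j \<in> K" if "j < ?k" for j
    using that by (auto simp: bij_betw_def)
  define B where "B = mat n ?k (\<lambda>(i, j). v (e j) $ i)"
  have B: "B \<in> carrier_mat n ?k"
    by (simp add: B_def)
  have "w = 0\<^sub>v ?k" if w: "w \<in> carrier_vec ?k" "B *\<^sub>v w = 0\<^sub>v n" for w
  proof (intro eq_vecI)
    fix j assume j: "j < dim_vec (0\<^sub>v ?k)"
    let ?c = "\<lambda>k. w $ (inv_into {0..<?k} e k)"
    have "(\<Sum>k\<in>K. ?c k * v k $ i) = 0" if "i < n" for i
    proof -
      have "(\<Sum>k\<in>K. ?c k * v k $ i) = (\<Sum>j\<in>{0..<?k}. ?c (e j) * v (e j) $ i)"
        by (rule sum.reindex_bij_betw[OF e, symmetric])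
      also have "\<dots> = (\<Sum>j\<in>{0..<?k}. v (e j) $ i * w $ j)"
        using e by (intro sum.cong) (auto simp: bij_betw_def inv_into_f_f)
      also have "\<dots> = (B *\<^sub>v w) $ i"
        using that w(1) by (simp add: B_def scalar_prod_def)
      finally show ?thesis
        using that w by simp
    qed
    from indep[of ?c, OF this eK] have "?c (e j) = 0"
      using j by auto
    then show "w $ j = 0\<^sub>v ?k $ j"
      using e j by (auto simp: bij_betw_def inv_into_f_f)
  qed (use w in auto)
  then obtain C where C: "C \<in> carrier_mat ?k n" "C * B = 1\<^sub>m ?k"
    using mat_left_inverse_exists[OF B] by blast
  have AB: "A * B = l \<cdot>\<^sub>m B"
  proof (rule mat_col_eqI)
    fix j assume "j < dim_col (l \<cdot>\<^sub>m B)"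
    then have j: "j < ?k"
      using B by auto
    have colB: "col B j = v (e j)"
      using v[OF eK[OF j]] j by (intro eq_vecI) (auto simp: B_def)
    have "col (A * B) j = A *\<^sub>v col B j"
      using A B j by (intro col_mult2) auto
    then show "col (A * B) j = col (l \<cdot>\<^sub>m B) j"
      using eigen[OF eK[OF j]] j B by (simp add: colB)
  qed (use A B in auto)
  let ?A' = "A - B * C"
  have A': "?A' \<in> carrier_mat n n"
    using A B C by auto
  \<comment> \<open>Checked at every real \<open>x\<close>; at \<open>x = l\<close> the determinant
    identity is used with \<open>a = 0\<close>.\<close>
  have "[:-l, 1:] ^ ?k * char_poly ?A' = [:1 - l, 1:] ^ ?k * char_poly A" (is "?p = ?q")
  proof (rule poly_ext)
    fix x
    have cp: "poly (char_poly M) x = det (x \<cdot>\<^sub>m 1\<^sub>m n - M)" if "M \<in> carrier_mat n n" for M :: "real mat"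
      using that unfolding char_poly_matrix[OF that] char_matrix_def
      by (intro arg_cong[where f = det] eq_matI) auto
    let ?X = "x \<cdot>\<^sub>m 1\<^sub>m n - A"
    have X: "?X \<in> carrier_mat n n"
      using A by auto
    have "?X * B = x \<cdot>\<^sub>m B - A * B"
      using A B by (simp add: minus_mult_distrib_mat[of _ n n] mult_smult_assoc_mat[of _ n n])
    also have "\<dots> = (x - l) \<cdot>\<^sub>m B"
      unfolding AB using B by (intro eq_matI) (auto simp: algebra_simps)
    finally have XB: "?X * B = (x - l) \<cdot>\<^sub>m B" .
    have "?X + B * C = x \<cdot>\<^sub>m 1\<^sub>m n - ?A'"
      using A B C by (intro eq_matI) auto
    with det_add_mult_eigen[OF X B C XB]
    show "poly ?p x = poly ?q x"
      by (simp add: cp[OF A] cp[OF A'] algebra_simps)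
  qed
  moreover have "?p \<noteq> 0" "?q \<noteq> 0"
    using degree_monic_char_poly[OF A] degree_monic_char_poly[OF A'] by auto
  moreover have "order l ([:1 - l, 1:] ^ ?k) = 0"
    by (intro order_0I) simp
  ultimately have "?k + order l (char_poly ?A') = order l (char_poly A)"
    by (metis add_0 order_mult order_power_n_n)
  then show ?thesis
    by simp
qed

text \<open>The lower bounds at distinct roots give an inclusion of multisets, and \<open>p\<close>
  has at most \<open>degree p\<close> roots, so the sizes force equality. Entries with multiplicity
  0 are allowed; they occur for \<open>d = 2\<close> and for \<open>n = d + 1\<close>.\<close>

lemma proots_eq_sum_replicate:
  fixes p :: "'a :: idom poly"
  assumes p: "p \<noteq> 0" and dist: "distinct (map snd ks)"
    and le: "\<And>k l. (k, l) \<in> set ks \<Longrightarrow> k \<le> order l p"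
    and deg: "degree p = sum_list (map fst ks)"
  shows "proots p = (\<Sum>(k, l)\<leftarrow>ks. replicate_mset k l)" (is "_ = ?M ks")
proof -
  have zero: "count (?M ks) x = 0" if "x \<notin> snd ` set ks" for x and ks :: "(nat \<times> 'a) list"
    using that by (induction ks) (auto split: prod.splits)
  have "count (?M ks) x \<le> order x p" for x
    using dist le
  proof (induction ks)
    case (Cons kl ks)
    obtain k l where kl: "kl = (k, l)"
      by force
    have "count (?M ks) x \<le> order x p"
      using Cons by auto
    moreover have "count (?M ks) l = 0"
      using Cons.prems(1) kl by (intro zero) auto
    ultimately show ?case
      using Cons.prems(2)[of k l] kl by auto
  qed simp
  then have "?M ks \<subseteq># proots p"
    using p by (simp add: subseteq_mset_def)
  moreover have "size (?M ks) = sum_list (map fst ks)"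
    by (induction ks) auto
  then have "size (proots p) \<le> size (?M ks)"
    using size_proots_le[of p] deg by simp
  ultimately show ?thesis
    by (metis mset_subset_size not_less subset_mset.nless_le)
qed

section \<open>The stiffness matrix acting on vector fields\<close>

lemma sum_lessThan_mult:
  fixes f :: "nat \<Rightarrow> 'a :: comm_monoid_add"
  shows "(\<Sum>k<n * d. f k) = (\<Sum>i<n. \<Sum>b<d. f (i * d + b))"
proof -
  have "(\<Sum>k\<in>{i * d..<i * d + d}. f k) = (\<Sum>b<d. f (i * d + b))" for i
    by (rule sum.reindex_bij_witness[of _ "\<lambda>b. i * d + b" "\<lambda>k. k - i * d"]) auto
  then show ?thesis
    by (simp add: sum.nat_group[symmetric])
qed

lemma sum_nth_distinct:
  assumes "distinct xs"
  shows "(\<Sum>i<length xs. f (xs ! i)) = sum f (set xs)"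
  using assms by (intro sum.reindex_bij_betw bij_betw_nth) auto

lemma mult_add_less_mult:
  fixes b d i n :: nat
  assumes "i < n" "b < d"
  shows "i * d + b < n * d"
proof -
  have "i * d + b < Suc i * d"
    using assms by simp
  also have "\<dots> \<le> n * d"
    using assms by (intro mult_le_mono1) simp
  finally show ?thesis .
qed

lemma dim_edge_dir:
  "p u \<in> carrier_vec d \<Longrightarrow> p v \<in> carrier_vec d \<Longrightarrow> dim_vec (edge_dir d p u v) = d"
  by (auto simp: edge_dir_def)

lemma rigidity_column_nth:
  assumes "p u \<in> carrier_vec d" "p v \<in> carrier_vec d" and "i < length vs" "c < d"
  shows "rigidity_column d vs p u v $ (i * d + c) =
    (of_bool (vs ! i = u) - of_bool (vs ! i = v)) * edge_dir d p u v $ c"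
  using assms mult_add_less_mult[of i "length vs" c d]
  by (simp add: rigidity_column_def kronecker_vec_def vertex_basis_vec_def dim_edge_dir)

lemma dim_rigidity_column:
  assumes "p u \<in> carrier_vec d" "p v \<in> carrier_vec d"
  shows "dim_vec (rigidity_column d vs p u v) = d * length vs"
  using assms
  by (simp add: rigidity_column_def kronecker_vec_def vertex_basis_vec_def dim_edge_dir)

text \<open>The layout is that of \<open>kronecker_vec\<close>: entry \<open>i * d + c\<close> is
  coordinate \<open>c\<close> at vertex \<open>vs ! i\<close>. Working with \<open>x\<close> itself
  hides the enumeration of the vertices.\<close>

definition field_vec :: "nat \<Rightarrow> 'v list \<Rightarrow> ('v \<Rightarrow> nat \<Rightarrow> real) \<Rightarrow> real vec" where
  "field_vec d vs x = vec (d * length vs) (\<lambda>k. x (vs ! (k div d)) (k mod d))"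

lemma field_vec_nth:
  "i < length vs \<Longrightarrow> c < d \<Longrightarrow> field_vec d vs x $ (i * d + c) = x (vs ! i) c"
  using mult_add_less_mult[of i "length vs" c d] by (simp add: field_vec_def mult.commute)

lemma field_vec_carrier [simp]: "field_vec d vs x \<in> carrier_vec (d * length vs)"
  by (simp add: field_vec_def)

text \<open>Only the blocks of \<open>u\<close> and \<open>v\<close> survive, with opposite signs.
  For distinct end points the value is the first-order change of the length of the edge under the
  velocity field \<open>x\<close>.\<close>

lemma rigidity_column_scalar_prod:
  assumes "p u \<in> carrier_vec d" "p v \<in> carrier_vec d"
    and "distinct vs" "u \<in> set vs" "v \<in> set vs"
  shows "rigidity_column d vs p u v \<bullet> field_vec d vs x =
    (\<Sum>b<d. edge_dir d p u v $ b * (x u b - x v b))"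
proof -
  let ?t = "\<lambda>w. \<Sum>b<d. edge_dir d p u v $ b * x w b"
  have "rigidity_column d vs p u v \<bullet> field_vec d vs x =
      (\<Sum>k<length vs * d. rigidity_column d vs p u v $ k * field_vec d vs x $ k)"
    by (simp add: scalar_prod_def field_vec_def mult.commute lessThan_atLeast0)
  also have "\<dots> = (\<Sum>i<length vs. (of_bool (vs ! i = u) - of_bool (vs ! i = v)) * ?t (vs ! i))"
    unfolding sum_lessThan_mult using assms(1,2)
    by (intro sum.cong refl)
      (simp add: rigidity_column_nth field_vec_nth sum_distrib_left mult.assoc)
  also have "\<dots> = (\<Sum>w\<in>set vs. (of_bool (w = u) - of_bool (w = v)) * ?t w)"
    by (rule sum_nth_distinct[OF assms(3)])
  also have "\<dots> = (\<Sum>w\<in>set vs. of_bool (w = u) * ?t w) - (\<Sum>w\<in>set vs. of_bool (w = v) * ?t w)"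
    by (simp add: left_diff_distrib sum_subtractf)
  also have "\<dots> = ?t u - ?t v"
    using assms(4,5) by (simp add: of_bool_def if_distrib[where f = "\<lambda>z. z * _"] cong: if_cong)
  finally show ?thesis
    by (simp add: right_diff_distrib sum_subtractf)
qed

text \<open>The listed orientation of each edge at \<open>w\<close> is irrelevant because \<open>f\<close> is symmetric.\<close>

lemma sum_incident_edges:
  fixes f :: "'v \<Rightarrow> 'v \<Rightarrow> real"
  assumes dist: "distinct (map (\<lambda>(u, v). {u, v}) es)"
    and loopfree: "\<And>u v. (u, v) \<in> set es \<Longrightarrow> u \<noteq> v"
    and sym: "\<And>u v. (u, v) \<in> set es \<Longrightarrow> f u v = f v u"
  shows "(\<Sum>(u, v)\<in>set es. of_bool (w = u \<or> w = v) * f u v) =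
    (\<Sum>v | {w, v} \<in> (\<lambda>(u, v). {u, v}) ` set es. f w v)"
proof -
  have inj: "inj_on (\<lambda>(u, v). {u, v}) (set es)"
    using dist by (simp add: distinct_map)
  have "(\<Sum>(u, v)\<in>set es. of_bool (w = u \<or> w = v) * f u v) =
      (\<Sum>(u, v)\<in>{(u, v)\<in>set es. w = u \<or> w = v}. f u v)"
    by (rule sum.mono_neutral_cong_right) auto
  also have "\<dots> = (\<Sum>v | {w, v} \<in> (\<lambda>(u, v). {u, v}) ` set es. f w v)"
  proof (rule sum.reindex_bij_witness
      [where i = "\<lambda>v. if (w, v) \<in> set es then (w, v) else (v, w)"
        and j = "\<lambda>(u, v). if u = w then v else u"])
    fix e assume e: "e \<in> {(u, v). (u, v) \<in> set es \<and> (w = u \<or> w = v)}"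
    obtain a b where ab: "e = (a, b)" "(a, b) \<in> set es" "w = a \<or> w = b"
      using e by auto
    have swap: "(b, a) \<notin> set es"
      using inj_onD[OF inj, of "(a, b)" "(b, a)"] ab loopfree[of a b] by (auto simp: insert_commute)
    show "(if (w, case e of (u, v) \<Rightarrow> if u = w then v else u) \<in> set es
        then (w, case e of (u, v) \<Rightarrow> if u = w then v else u)
        else (case e of (u, v) \<Rightarrow> if u = w then v else u, w)) = e"
      using ab swap loopfree[of a b] by auto
    show "(case e of (u, v) \<Rightarrow> if u = w then v else u)
        \<in> {v. {w, v} \<in> (\<lambda>(u, v). {u, v}) ` set es}"
      using ab by (force simp: insert_commute)
    show "f w (case e of (u, v) \<Rightarrow> if u = w then v else u) = (case e of (u, v) \<Rightarrow> f u v)"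
      using ab sym[of a b] by auto
  next
    fix v assume "v \<in> {v. {w, v} \<in> (\<lambda>(u, v). {u, v}) ` set es}"
    then have v: "(w, v) \<in> set es \<or> (v, w) \<in> set es"
      by (auto simp: doubleton_eq_iff)
    then show "(case if (w, v) \<in> set es then (w, v) else (v, w) of
        (u, v) \<Rightarrow> if u = w then v else u) = v"
      using loopfree by auto
    show "(if (w, v) \<in> set es then (w, v) else (v, w))
        \<in> {(u, v). (u, v) \<in> set es \<and> (w = u \<or> w = v)}"
      using v by auto
  qed
  finally show ?thesis .
qed

lemma stiffness_matrix_carrier [simp]:
  "stiffness_matrix d vs es p \<in> carrier_mat (d * length vs) (d * length vs)"
  by (simp add: stiffness_matrix_def rigidity_matrix_def carrier_matI)

text \<open>The transposed rigidity matrix turns \<open>x\<close> into one number per edge, and the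
  rigidity matrix sums these along the edge directions at each vertex. The result is a sum over
  neighbours, free of the enumeration and orientation of the edges.\<close>

lemma stiffness_matrix_mult_field_vec:
  assumes graph: "enumerates_graph V E vs es"
    and edges: "\<And>u v. {u, v} \<in> E \<Longrightarrow> u \<in> V \<and> v \<in> V \<and> u \<noteq> v"
    and p: "\<And>v. v \<in> V \<Longrightarrow> p v \<in> carrier_vec d"
    and y: "\<And>w c. w \<in> V \<Longrightarrow> c < d \<Longrightarrow>
      y w c = (\<Sum>v | {w, v} \<in> E. edge_dir d p w v $ c *
        (\<Sum>b<d. edge_dir d p w v $ b * (x w b - x v b)))"
  shows "stiffness_matrix d vs es p *\<^sub>v field_vec d vs x = field_vec d vs y"
proof (rule eq_vecI)
  have vs: "distinct vs" "set vs = V" and es: "distinct (map (\<lambda>(u, v). {u, v}) es)"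
    and E: "E = (\<lambda>(u, v). {u, v}) ` set es"
    using graph by (auto simp: enumerates_graph_def)
  have "{u, v} \<in> E" if "(u, v) \<in> set es" for u v
    using that by (auto simp: E intro!: rev_image_eqI)
  then have es_edge: "u \<in> V" "v \<in> V" "u \<noteq> v" if "(u, v) \<in> set es" for u v
    using that edges by blast+
  let ?N = "d * length vs"
  let ?R = "rigidity_matrix d vs es p"
  let ?X = "field_vec d vs x"
  let ?col = "\<lambda>e. case e of (u, v) \<Rightarrow> rigidity_column d vs p u v"
  have R: "?R \<in> carrier_mat ?N (length es)"
    by (simp add: rigidity_matrix_def carrier_matI)
  have col: "?col e \<in> carrier_vec ?N" if "e \<in> set es" for e
    using that es_edge p by (auto intro!: carrier_vecI dim_rigidity_column split: prod.splits)
  have colR: "col ?R j = ?col (es ! j)" if "j < length es" for j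
    unfolding rigidity_matrix_def using that col[of "es ! j"]
    by (subst col_mat_of_cols) auto
  fix k assume "k < dim_vec (field_vec d vs y)"
  then have k: "k < length vs * d"
    by (simp add: field_vec_def mult.commute)
  define i c where "i = k div d" and "c = k mod d"
  have ic: "i < length vs" "c < d" "k = i * d + c"
    using k by (cases "d = 0"; simp add: i_def c_def less_mult_imp_div_less)+
  let ?w = "vs ! i"
  have w: "?w \<in> V"
    using ic vs by auto
  let ?f = "\<lambda>u v. edge_dir d p u v $ c * (\<Sum>b<d. edge_dir d p u v $ b * (x u b - x v b))"
  let ?g = "\<lambda>(u, v). (of_bool (?w = u) - of_bool (?w = v)) * edge_dir d p u v $ c *
      (\<Sum>b<d. edge_dir d p u v $ b * (x u b - x v b))"
  have "(stiffness_matrix d vs es p *\<^sub>v ?X) = ?R *\<^sub>v (transpose_mat ?R *\<^sub>v ?X)"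
    unfolding stiffness_matrix_def using R by (intro assoc_mult_mat_vec[of _ ?N _ _ ?N]) auto
  also have "\<dots> $ k = (\<Sum>j<length es. ?R $$ (k, j) * (col ?R j \<bullet> ?X))"
    using R k by (simp add: scalar_prod_def mult.commute lessThan_atLeast0)
  also have "\<dots> = (\<Sum>j<length es. ?g (es ! j))"
  proof (intro sum.cong refl)
    fix j assume j: "j \<in> {..<length es}"
    obtain u v where uv: "es ! j = (u, v)"
      by force
    then have "(u, v) \<in> set es"
      using j nth_mem by fastforce
    then have V: "u \<in> V" "v \<in> V"
      using es_edge by auto
    have "?R $$ (k, j) = col ?R j $ k"
      using R j k by (simp add: mult.commute)
    then show "?R $$ (k, j) * (col ?R j \<bullet> ?X) = ?g (es ! j)"
      using j uv V vs ic p by (simp add: colR rigidity_column_nth rigidity_column_scalar_prod)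
  qed
  also have "\<dots> = sum ?g (set es)"
    using es by (intro sum_nth_distinct) (simp add: distinct_map)
  \<comment> \<open>The incidence indicator only matches the shape of
    \<open>sum_incident_edges\<close>: the difference of indicators is already zero at edges that
    miss \<open>?w\<close>.\<close>
  also have "\<dots> = (\<Sum>(u, v)\<in>set es. of_bool (?w = u \<or> ?w = v) *
      ((of_bool (?w = u) - of_bool (?w = v)) * edge_dir d p u v $ c *
        (\<Sum>b<d. edge_dir d p u v $ b * (x u b - x v b))))"
    by (intro sum.cong) auto
  also have "\<dots> = (\<Sum>v | {?w, v} \<in> E. (of_bool (?w = ?w) - of_bool (?w = v)) * edge_dir d p ?w v $ c *
        (\<Sum>b<d. edge_dir d p ?w v $ b * (x ?w b - x v b)))"
    unfolding E
  proof (rule sum_incident_edges[OF es])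
    fix u v assume uv: "(u, v) \<in> set es"
    then have V: "u \<in> V" "v \<in> V"
      using es_edge by auto
    then have "edge_dir d p u v $ b = - edge_dir d p v u $ b" if "b < d" for b
      using that edge_dir_commute[of p u d v] p dim_edge_dir[of p u d v] by auto
    \<comment> \<open>Reversing the edge changes four signs: the indicator difference, both
      occurrences of the direction, and the difference of \<open>x\<close>.\<close>
    then show "(of_bool (?w = u) - of_bool (?w = v)) * edge_dir d p u v $ c *
        (\<Sum>b<d. edge_dir d p u v $ b * (x u b - x v b)) =
      (of_bool (?w = v) - of_bool (?w = u)) * edge_dir d p v u $ c *
        (\<Sum>b<d. edge_dir d p v u $ b * (x v b - x u b))"
      using ic by (simp add: algebra_simps sum_subtractf sum_negf)
  qed (use es_edge in auto)
  also have "\<dots> = (\<Sum>v | {?w, v} \<in> E. ?f ?w v)"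
    using edges by (intro sum.cong) auto
  also have "\<dots> = field_vec d vs y $ k"
    using ic w by (simp add: y field_vec_nth)
  finally show "(stiffness_matrix d vs es p *\<^sub>v ?X) $ k = field_vec d vs y $ k" .
qed (simp add: stiffness_matrix_def rigidity_matrix_def field_vec_def)

section \<open>Auxiliary facts for the independence arguments\<close>

text \<open>Reads off one coefficient of a linear combination at a coordinate where all other
  vectors vanish.\<close>

lemma sum_mult_single:
  fixes c :: "'b \<Rightarrow> 'a :: semiring_1"
  assumes "finite K" "k \<in> K" "f k = 1" "\<And>k'. k' \<in> K \<Longrightarrow> k' \<noteq> k \<Longrightarrow> f k' = 0"
  shows "(\<Sum>k\<in>K. c k * f k) = c k"
proof -
  have "(\<Sum>k'\<in>K. c k' * f k') = (\<Sum>k'\<in>K. if k' = k then c k else 0)"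
    using assms by (intro sum.cong) auto
  then show ?thesis
    using assms by simp
qed

text \<open>An odd cycle forces this: as \<open>2 \<le> d\<close>, there are three distinct indices,
  and going around them changes the sign of \<open>y i\<close> three times.\<close>

lemma triangle_alternating_zero:
  fixes y :: "nat \<Rightarrow> real"
  assumes "2 \<le> d" and y: "\<And>i j. i \<le> d \<Longrightarrow> j \<le> d \<Longrightarrow> i \<noteq> j \<Longrightarrow> y i = - y j" and "i \<le> d"
  shows "y i = 0"
proof -
  obtain j k where "j \<le> d" "k \<le> d" "i \<noteq> j" "i \<noteq> k" "j \<noteq> k"
  proof (cases "i = 0 \<or> i = 1")
    case True
    then show ?thesis using that[of "1 - i" 2] assms(1) by auto
  next
    case False
    then show ?thesis using that[of 0 1] assms(1) by auto
  qed
  then show ?thesis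
    using y[of i j] y[of i k] y[of j k] assms(3) by simp
qed

section \<open>The stiffness operator in simplex edge coordinates\<close>

text \<open>All the geometry that is kept: \<open>D i j\<close> is the unit direction of the simplex
  edge between vertices \<open>i\<close> and \<open>j\<close>, and two edges at a vertex enclose 60
  degrees. The matrix \<open>A\<close> enters only through its size and its action on
  fields.\<close>

locale simplex_multipartite =
  fixes d m :: nat and V :: "'v set" and part :: "'v \<Rightarrow> nat" and D :: "nat \<Rightarrow> nat \<Rightarrow> nat \<Rightarrow> real"
    and vs :: "'v list" and A :: "real mat"
  assumes d: "2 \<le> d" and m: "0 < m" and distinct_vs: "distinct vs" and set_vs: "set vs = V"
    and part_le: "v \<in> V \<Longrightarrow> part v \<le> d"
    and card_part: "i \<le> d \<Longrightarrow> card {v \<in> V. part v = i} = m"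
    and D_swap: "i \<le> d \<Longrightarrow> j \<le> d \<Longrightarrow> i \<noteq> j \<Longrightarrow> c < d \<Longrightarrow> D j i c = - D i j c"
    and D_inner: "i \<le> d \<Longrightarrow> j \<le> d \<Longrightarrow> k \<le> d \<Longrightarrow> j \<noteq> i \<Longrightarrow> k \<noteq> i \<Longrightarrow>
      (\<Sum>c<d. D i j c * D i k c) = (if j = k then 1 else 1 / 2)"
    and A: "A \<in> carrier_mat (d * length vs) (d * length vs)"
    and A_field: "(\<And>w c. w \<in> V \<Longrightarrow> c < d \<Longrightarrow> y w c = (\<Sum>v | v \<in> V \<and> part v \<noteq> part w.
        D (part w) (part v) c * (\<Sum>b<d. D (part w) (part v) b * (x w b - x v b)))) \<Longrightarrow>
      A *\<^sub>v field_vec d vs x = field_vec d vs y"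
begin

definition row_total :: "('v \<Rightarrow> nat \<Rightarrow> real) \<Rightarrow> 'v \<Rightarrow> real" where
  "row_total g w = (\<Sum>j\<in>{..d} - {part w}. g w j)"

text \<open>A vector at \<open>w\<close> is encoded by its coefficients \<open>g w j\<close> (\<open>j \<noteq> part w\<close>) with respect to
  the edge directions at its simplex vertex; \<open>frame_op\<close> is the stiffness operator in these
  coordinates. It no longer depends on the position of the simplex.\<close>

definition frame_op :: "('v \<Rightarrow> nat \<Rightarrow> real) \<Rightarrow> 'v \<Rightarrow> nat \<Rightarrow> real" where
  "frame_op g w j = real m / 2 * (g w j + row_total g w) +
     (\<Sum>v | v \<in> V \<and> part v = j. g v (part w) + row_total g v) / 2"

definition frame :: "('v \<Rightarrow> nat \<Rightarrow> real) \<Rightarrow> 'v \<Rightarrow> nat \<Rightarrow> real" where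
  "frame g w c = (\<Sum>j\<in>{..d} - {part w}. g w j * D (part w) j c)"

lemma finite_V [simp]: "finite V"
  using set_vs by auto

lemma sum_over_parts: "(\<Sum>i\<le>d. \<Sum>v | v \<in> V \<and> part v = i. f v) = sum f V"
  using part_le by (intro sum.group) auto

lemma card_V: "card V = m * (d + 1)"
  using sum_over_parts[of "\<lambda>_. 1 :: nat"] card_part by (simp add: algebra_simps)

lemma part_nonempty:
  assumes "i \<le> d"
  obtains v where "v \<in> V" "part v = i"
  using card_part[OF assms] m by (metis (mono_tags, lifting) Collect_empty_eq card.empty less_irrefl)

text \<open>By \<open>D_inner\<close> the Gram matrix of the directions at a vertex is half the sum
  of the identity and the all-ones matrix; the latter produces the row total.\<close>

lemma frame_inner:
  assumes "w \<in> V" "k \<le> d" "k \<noteq> part w"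
  shows "(\<Sum>b<d. D (part w) k b * frame g w b) = (g w k + row_total g w) / 2"
proof -
  let ?J = "{..d} - {part w}"
  have "(\<Sum>b<d. D (part w) k b * frame g w b) =
      (\<Sum>j\<in>?J. g w j * (\<Sum>b<d. D (part w) k b * D (part w) j b))"
    unfolding frame_def sum_distrib_left by (subst sum.swap) (simp add: mult.left_commute)
  also have "\<dots> = (\<Sum>j\<in>?J. (if k = j then g w j / 2 else 0) + g w j / 2)"
    using assms part_le by (intro sum.cong refl) (auto simp: D_inner)
  also have "\<dots> = (g w k + row_total g w) / 2"
    using assms by (simp add: sum.distrib row_total_def sum_divide_distrib add_divide_distrib)
  finally show ?thesis .
qed

text \<open>The directions at a vertex are independent: each coefficient equals minus the row total,
  and adding the \<open>d\<close> of them gives \<open>(1 + d) * row_total g w = 0\<close>.\<close>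

lemma frame_eq_0_imp:
  assumes "w \<in> V" "\<And>c. c < d \<Longrightarrow> frame g w c = 0" and j: "j \<le> d" "j \<noteq> part w"
  shows "g w j = 0"
proof -
  have eq: "g w k = - row_total g w" if "k \<le> d" "k \<noteq> part w" for k
    using frame_inner[OF assms(1) that, of g] assms(2) by simp
  have "row_total g w = (\<Sum>k\<in>{..d} - {part w}. g w k)"
    by (simp add: row_total_def)
  also have "\<dots> = (\<Sum>k\<in>{..d} - {part w}. - row_total g w)"
    using eq by (intro sum.cong) auto
  also have "\<dots> = - real d * row_total g w"
    using part_le[OF assms(1)] by simp
  finally have "(1 + real d) * row_total g w = 0"
    by (simp add: algebra_simps)
  then have "row_total g w = 0"
    by (simp add: add_nonneg_eq_0_iff)
  then show ?thesis
    using eq[OF j] by simp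
qed

text \<open>All neighbours in part \<open>j\<close> are seen along the same direction
  \<open>D ?i j\<close>. Grouping them by part thus expands the image in the directions at
  \<open>w\<close>, with \<open>frame_op\<close> as coefficients.\<close>

lemma A_frame: "A *\<^sub>v field_vec d vs (frame g) = field_vec d vs (frame (frame_op g))"
proof (rule A_field)
  fix w c assume w: "w \<in> V" and c: "c < d"
  let ?i = "part w"
  let ?h = "\<lambda>v. D ?i (part v) c * (\<Sum>b<d. D ?i (part v) b * (frame g w b - frame g v b))"
  have "(\<Sum>v | v \<in> V \<and> part v \<noteq> ?i. ?h v) =
      (\<Sum>j\<in>{..d} - {?i}. \<Sum>v\<in>{v. v \<in> {v. v \<in> V \<and> part v \<noteq> ?i} \<and> part v = j}. ?h v)"
    using part_le by (intro sum.group[symmetric]) auto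
  also have "\<dots> = (\<Sum>j\<in>{..d} - {?i}. frame_op g w j * D ?i j c)"
  proof (intro sum.cong refl)
    fix j assume "j \<in> {..d} - {?i}"
    then have j: "j \<le> d" "j \<noteq> ?i"
      by auto
    have "(\<Sum>b<d. D ?i j b * (frame g w b - frame g v b)) =
        (g w j + row_total g w + g v ?i + row_total g v) / 2" if "v \<in> V" "part v = j" for v
    proof -
      \<comment> \<open>At \<open>v\<close> the frame consists of the directions
        \<open>D j k\<close>, so \<open>D ?i j\<close> has to be reversed; this turns the difference
        into a sum.\<close>
      have "(\<Sum>b<d. D ?i j b * frame g v b) = - (\<Sum>b<d. D (part v) ?i b * frame g v b)"
        unfolding sum_negf[symmetric]
        using D_swap[of j ?i] that j part_le[OF w] by (intro sum.cong) auto
      then show ?thesis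
        using frame_inner[OF w j, of g] frame_inner[OF that(1) part_le[OF w], of g] that j
        by (simp add: right_diff_distrib sum_subtractf add_divide_distrib)
    qed
    then have "(\<Sum>v\<in>{v. v \<in> {v. v \<in> V \<and> part v \<noteq> ?i} \<and> part v = j}. ?h v) =
        (\<Sum>v | v \<in> V \<and> part v = j. D ?i j c * ((g w j + row_total g w + g v ?i + row_total g v) / 2))"
      using j by (intro sum.cong) auto
    also have "\<dots> = D ?i j c * (((\<Sum>v | v \<in> V \<and> part v = j. g w j + row_total g w) +
        (\<Sum>v | v \<in> V \<and> part v = j. g v ?i + row_total g v)) / 2)"
      unfolding sum.distrib[symmetric] sum_distrib_left sum_divide_distrib
      by (intro sum.cong) (simp_all add: add.assoc)
    also have "\<dots> = frame_op g w j * D ?i j c"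
      using card_part[OF j(1)] by (simp add: frame_op_def add_divide_distrib mult.commute)
    finally show "(\<Sum>v\<in>{v. v \<in> {v. v \<in> V \<and> part v \<noteq> ?i} \<and> part v = j}. ?h v) =
        frame_op g w j * D ?i j c" .
  qed
  finally show "frame (frame_op g) w c = (\<Sum>v | v \<in> V \<and> part v \<noteq> ?i. ?h v)"
    by (simp add: frame_def)
qed

text \<open>Eigenvectors may be given by coefficients. Only those with
  \<open>j \<noteq> part w\<close> are constrained, since \<open>frame\<close> and
  \<open>row_total\<close> read no others.\<close>

lemma card_le_order:
  assumes K: "finite K"
    and eigen: "\<And>k w j. k \<in> K \<Longrightarrow> w \<in> V \<Longrightarrow> j \<le> d \<Longrightarrow> j \<noteq> part w \<Longrightarrow>
      frame_op (g k) w j = l * g k w j"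
    and indep: "\<And>c k. (\<And>w j. w \<in> V \<Longrightarrow> j \<le> d \<Longrightarrow> j \<noteq> part w \<Longrightarrow> (\<Sum>k\<in>K. c k * g k w j) = 0) \<Longrightarrow>
      k \<in> K \<Longrightarrow> c k = 0"
  shows "card K \<le> order l (char_poly A)"
proof (rule order_char_poly_ge_card[OF A K, of "\<lambda>k. field_vec d vs (frame (g k))"])
  have fv: "field_vec d vs x = field_vec d vs y" if "\<And>w c. w \<in> V \<Longrightarrow> x w c = y w c" for x y
  proof (rule eq_vecI)
    fix i assume "i < dim_vec (field_vec d vs y)"
    then have i: "i < d * length vs"
      by (simp add: field_vec_def)
    then have "i div d < length vs"
      by (simp add: less_mult_imp_div_less mult.commute)
    then show "field_vec d vs x $ i = field_vec d vs y $ i"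
      using i that set_vs by (auto simp: field_vec_def)
  qed (simp add: field_vec_def)
  fix k assume k: "k \<in> K"
  have "frame (frame_op (g k)) w c = l * frame (g k) w c" if "w \<in> V" for w c
    unfolding frame_def sum_distrib_left using eigen[OF k that] by (intro sum.cong) auto
  then have "field_vec d vs (frame (frame_op (g k))) = field_vec d vs (\<lambda>w c. l * frame (g k) w c)"
    by (rule fv)
  also have "\<dots> = l \<cdot>\<^sub>v field_vec d vs (frame (g k))"
    by (intro eq_vecI) (auto simp: field_vec_def)
  finally show "A *\<^sub>v field_vec d vs (frame (g k)) = l \<cdot>\<^sub>v field_vec d vs (frame (g k))"
    by (simp add: A_frame)
next
  fix c :: "'a \<Rightarrow> real" and k
  assume 0: "\<And>i. i < d * length vs \<Longrightarrow> (\<Sum>k\<in>K. c k * field_vec d vs (frame (g k)) $ i) = 0"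
    and k: "k \<in> K"
  show "c k = 0"
  proof (rule indep[OF _ k])
    fix w j assume w: "w \<in> V" and j: "j \<le> d" "j \<noteq> part w"
    obtain i where i: "i < length vs" "w = vs ! i"
      using w set_vs by (auto simp: in_set_conv_nth)
    have "frame (\<lambda>w j. \<Sum>k\<in>K. c k * g k w j) w b = 0" if b: "b < d" for b
    proof -
      have "frame (\<lambda>w j. \<Sum>k\<in>K. c k * g k w j) w b = (\<Sum>k\<in>K. c k * frame (g k) w b)"
        unfolding frame_def sum_distrib_left sum_distrib_right
        by (subst sum.swap) (simp add: mult.assoc)
      also have "\<dots> = (\<Sum>k\<in>K. c k * field_vec d vs (frame (g k)) $ (i * d + b))"
        by (simp only: field_vec_nth[OF i(1) b] i(2))
      also have "\<dots> = 0"
        using mult_add_less_mult[OF i(1) b] by (intro 0) (simp add: mult.commute)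
      finally show ?thesis .
    qed
    from frame_eq_0_imp[OF w this j] show "(\<Sum>k\<in>K. c k * g k w j) = 0" .
  qed
qed (auto)

section \<open>Eigenvectors for \<open>m / 2\<close>, \<open>m (d + 1) / 2\<close> and
  \<open>m (d + 1)\<close>\<close>

text \<open>Each eigenvector is the product of a difference of two vertices in one part and a
  difference of two directions at that part. All sums in \<open>frame_op\<close> vanish and only the
  factor \<open>m / 2\<close> is left.\<close>

lemma order_half_parts:
  "(card V - (d + 1)) * (d - 1) \<le> order (real m / 2) (char_poly A)"
proof -
  have "\<exists>v. v \<in> V \<and> part v = i" if "i \<le> d" for i
    using part_nonempty[OF that] by blast
  then obtain base where base: "\<And>i. i \<le> d \<Longrightarrow> base i \<in> V \<and> part (base i) = i"
    by metis
  \<comment> \<open>A reference direction for part \<open>i\<close>: any index up to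
    \<open>d\<close> other than \<open>i\<close> would do.\<close>
  define r where "r i = (if i = 0 then 1 else 0 :: nat)" for i :: nat
  have r: "r i \<le> d" "r i \<noteq> i" for i :: nat
    using d by (auto simp: r_def)
  \<comment> \<open>One base vertex per part is left out, and at each other vertex its own part and
    the reference direction; this leaves \<open>d - 1\<close> choices of direction.\<close>
  define K where "K = (SIGMA u:V - base ` {..d}. {..d} - {part u, r (part u)})"
  have finK: "finite K"
    by (simp add: K_def)
  have "inj_on base {..d}"
    using base by (intro inj_on_inverseI[of _ part]) auto
  then have "card (V - base ` {..d}) = card V - (d + 1)"
    using base by (subst card_Diff_subset) (auto simp: card_image)
  moreover have "card ({..d} - {part u, r (part u)}) = d - 1" if "u \<in> V" for u
    using part_le[OF that] r[of "part u"] by (subst card_Diff_subset) (auto simp: card_insert_if)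
  ultimately have cardK: "card K = (card V - (d + 1)) * (d - 1)"
    by (simp add: K_def)
  define g :: "'v \<times> nat \<Rightarrow> 'v \<Rightarrow> nat \<Rightarrow> real" where
    "g = (\<lambda>(u, j) w l. (of_bool (w = u) - of_bool (w = base (part u))) *
      (of_bool (l = j) - of_bool (l = r (part u))))"
  have "card K \<le> order (real m / 2) (char_poly A)"
  proof (rule card_le_order[OF finK, of g])
    fix k w l assume k: "k \<in> K" and w: "w \<in> V" "l \<le> d" "l \<noteq> part w"
    obtain u j where uj: "k = (u, j)" "u \<in> V" "j \<le> d" "j \<noteq> part u" "j \<noteq> r (part u)"
      using k by (auto simp: K_def)
    have pu: "part u \<le> d" "base (part u) \<in> V" "part (base (part u)) = part u"
      using base part_le uj by auto
    have row: "row_total (g k) v = 0" if v: "v \<in> V" for v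
    proof (cases "part v = part u")
      case True
      have "(\<Sum>l\<in>{..d} - {part u}. of_bool (l = j) - of_bool (l = r (part u))) = (0 :: real)"
        using uj r[of "part u"] by (simp add: of_bool_def sum_subtractf)
      then show ?thesis
        using True by (simp add: row_total_def g_def uj sum_distrib_left[symmetric])
    next
      case False
      then have "v \<noteq> u" "v \<noteq> base (part u)"
        using pu by auto
      then show ?thesis
        by (simp add: row_total_def g_def uj)
    qed
    have "(\<Sum>v | v \<in> V \<and> part v = l. of_bool (v = u) - of_bool (v = base (part u))) = (0 :: real)"
      using uj pu by (simp add: of_bool_def sum_subtractf)
    then have "(\<Sum>v | v \<in> V \<and> part v = l. g k v (part w)) = 0"
      by (simp only: g_def uj prod.case sum_distrib_right[symmetric] mult_zero_left)
    then show "frame_op (g k) w l = real m / 2 * g k w l"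
      using row w by (simp add: frame_op_def)
  next
    fix c k assume 0: "\<And>w j. w \<in> V \<Longrightarrow> j \<le> d \<Longrightarrow> j \<noteq> part w \<Longrightarrow> (\<Sum>k\<in>K. c k * g k w j) = 0"
      and k: "k \<in> K"
    obtain u j where uj: "k = (u, j)" "u \<in> V" "u \<notin> base ` {..d}" "j \<le> d" "j \<noteq> part u" "j \<noteq> r (part u)"
      using k by (auto simp: K_def)
    have ub: "u \<noteq> base (part v)" if "v \<in> V" for v
      using uj part_le[OF that] by auto
    \<comment> \<open>As \<open>u\<close> is no base vertex and \<open>j\<close> is not the
      reference direction, only the vector of \<open>k\<close> itself is nonzero at
      \<open>(u, j)\<close>.\<close>
    have "(\<Sum>k\<in>K. c k * g k u j) = c k"
      using ub uj by (intro sum_mult_single finK k) (auto simp: g_def K_def)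
    then show "c k = 0"
      using 0[of u j] uj by simp
  qed
  then show ?thesis
    by (simp add: cardK)
qed

lemma order_half_all:
  "card V - 1 \<le> order (real m * (real d + 1) / 2) (char_poly A)"
proof -
  obtain w0 where w0: "w0 \<in> V"
    using part_nonempty[of 0] by auto
  define avg :: "('v \<Rightarrow> real) \<Rightarrow> nat \<Rightarrow> real" where
    "avg h i = (\<Sum>v | v \<in> V \<and> part v = i. h v) / m" for h i
  have sum_part: "(\<Sum>v | v \<in> V \<and> part v = i. h v) = m * avg h i" for h i
    using m by (simp add: avg_def)
  define h :: "'v \<Rightarrow> 'v \<Rightarrow> real" where "h u w = of_bool (w = u) - of_bool (w = w0)" for u w
  define g where "g u w l = h u w + avg (h u) l" for u w l
  have "card (V - {w0}) \<le> order (real m * (real d + 1) / 2) (char_poly A)"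
  proof (rule card_le_order[of _ g])
    fix u w l assume u: "u \<in> V - {w0}" and w: "w \<in> V" and l: "l \<le> d" "l \<noteq> part w"
    have "sum (h u) V = 0"
      using u w0 by (simp add: h_def sum_subtractf of_bool_def)
    then have "(\<Sum>i\<le>d. m * avg (h u) i) = 0"
      using sum_over_parts[of "h u"] by (simp add: sum_part)
    then have "(\<Sum>i\<le>d. avg (h u) i) = 0"
      using m by (simp add: sum_distrib_left[symmetric])
    \<comment> \<open>The averages over all parts add up to zero, so leaving out the own part yields
      minus its average.\<close>
    then have row: "row_total (g u) v = d * h u v - avg (h u) (part v)" if "v \<in> V" for v
      using part_le[OF that] by (simp add: row_total_def g_def sum.distrib sum_diff1)
    have "(\<Sum>v | v \<in> V \<and> part v = l. g u v (part w) + row_total (g u) v) =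
        (\<Sum>v | v \<in> V \<and> part v = l. (d + 1) * h u v + (avg (h u) (part w) - avg (h u) l))"
      by (intro sum.cong) (auto simp: row g_def algebra_simps)
    also have "\<dots> = (d + 1) * (m * avg (h u) l) + m * (avg (h u) (part w) - avg (h u) l)"
      unfolding sum.distrib sum_distrib_left[symmetric] sum_part[of "h u"] by (simp add: card_part[OF l(1)])
    finally show "frame_op (g u) w l = real m * (real d + 1) / 2 * g u w l"
      by (simp add: frame_op_def row[OF w]) (simp add: g_def field_simps)
  next
    fix c u assume 0: "\<And>w j. w \<in> V \<Longrightarrow> j \<le> d \<Longrightarrow> j \<noteq> part w \<Longrightarrow> (\<Sum>k\<in>V - {w0}. c k * g k w j) = 0"
      and u: "u \<in> V - {w0}"
    define H where "H w = (\<Sum>k\<in>V - {w0}. c k * h k w)" for w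
    have "(\<Sum>k\<in>V - {w0}. c k * avg (h k) i) = avg H i" for i
      unfolding avg_def H_def sum_divide_distrib sum_distrib_left by (subst sum.swap) simp
    \<comment> \<open>The combination again has the form of \<open>g\<close>, now with
      \<open>H\<close> in place of \<open>h u\<close>. Averaging over a part makes the part averages
      alternate in sign, hence vanish.\<close>
    then have H: "H w = - avg H j" if "w \<in> V" "j \<le> d" "j \<noteq> part w" for w j
      using 0[OF that] by (simp add: g_def H_def distrib_left sum.distrib)
    have "avg H i = 0" if "i \<le> d" for i
    proof (rule triangle_alternating_zero[OF d _ that])
      fix i j assume ij: "i \<le> d" "j \<le> d" "i \<noteq> j"
      then have "m * avg H i = (\<Sum>v | v \<in> V \<and> part v = i. - avg H j)"
        unfolding sum_part[symmetric] by (intro sum.cong) (auto intro!: H)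
      then have "m * avg H i = m * (- avg H j)"
        using ij by (simp add: card_part)
      then show "avg H i = - avg H j"
        using m by (simp only: mult_cancel_left) simp
    qed
    moreover obtain j where "j \<le> d" "j \<noteq> part u"
      using that[of "if part u = 0 then 1 else 0"] d by simp
    ultimately have "H u = 0"
      using H[of u j] u by simp
    moreover have "H u = c u"
      unfolding H_def using u by (intro sum_mult_single) (auto simp: h_def)
    ultimately show "c u = 0"
      by simp
  qed auto
  then show ?thesis
    using w0 by simp
qed

text \<open>For a simplex this field is a dilation: the sum of the edge directions at a vertex is
  proportional to its position relative to the centroid.\<close>

lemma order_all: "1 \<le> order (real m * (real d + 1)) (char_poly A)"
proof -
  have "card {()} \<le> order (real m * (real d + 1)) (char_poly A)"
  proof (rule card_le_order[of _ "\<lambda>_ _ _. 1"])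
    fix w l assume w: "w \<in> V" and l: "l \<le> d" "l \<noteq> part w"
    have "row_total (\<lambda>_ _. 1) v = d" if "v \<in> V" for v
      using part_le[OF that] by (simp add: row_total_def)
    then show "frame_op (\<lambda>_ _. 1) w l = real m * (real d + 1) * 1"
      using w card_part[OF l(1)] by (simp add: frame_op_def field_simps)
  next
    fix c :: "unit \<Rightarrow> real" and k
    assume *: "\<And>w j. w \<in> V \<Longrightarrow> j \<le> d \<Longrightarrow> j \<noteq> part w \<Longrightarrow> (\<Sum>k\<in>{()}. c k * 1) = 0"
    obtain w where "w \<in> V" "part w = 0"
      using part_nonempty[of 0] by auto
    with *[of w 1] d show "c k = 0"
      by simp
  qed auto
  then show ?thesis
    by simp
qed

section \<open>Eigenvectors that depend only on the parts, for \<open>0\<close> and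
  \<open>m\<close>\<close>

lemma frame_op_part:
  assumes "w \<in> V" "j \<le> d"
  shows "frame_op (\<lambda>v. h (part v)) w j = real m / 2 * (h (part w) j + h j (part w) +
    (\<Sum>l\<in>{..d} - {part w}. h (part w) l) + (\<Sum>l\<in>{..d} - {j}. h j l))"
proof -
  have "(\<Sum>v | v \<in> V \<and> part v = j. h (part v) (part w) + row_total (\<lambda>v. h (part v)) v) =
      (\<Sum>v | v \<in> V \<and> part v = j. h j (part w) + (\<Sum>l\<in>{..d} - {j}. h j l))"
    by (intro sum.cong) (auto simp: row_total_def)
  then show ?thesis
    using card_part[OF assms(2)] by (simp add: frame_op_def row_total_def algebra_simps)
qed

lemma sum_of_bool_Diff:
  assumes "b \<le> d"
  shows "(\<Sum>l\<in>{..d} - {i}. of_bool (l = b)) = (of_bool (b \<noteq> i) :: real)"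
  using assms by (simp only: of_bool_def sum.delta finite_Diff finite_atMost) simp

text \<open>Coefficients constant on parts reduce the problem to functions on ordered pairs of
  simplex vertices. No part is empty, so a combination that vanishes on the graph vanishes at every
  pair.\<close>

lemma card_le_order_part:
  assumes K: "finite K"
    and eigen: "\<And>k i j. k \<in> K \<Longrightarrow> i \<le> d \<Longrightarrow> j \<le> d \<Longrightarrow> i \<noteq> j \<Longrightarrow>
      real m / 2 * (h k i j + h k j i + (\<Sum>l\<in>{..d} - {i}. h k i l) + (\<Sum>l\<in>{..d} - {j}. h k j l)) =
        l * h k i j"
    and indep: "\<And>c k. (\<And>i j. i \<le> d \<Longrightarrow> j \<le> d \<Longrightarrow> i \<noteq> j \<Longrightarrow> (\<Sum>k\<in>K. c k * h k i j) = 0) \<Longrightarrow>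
      k \<in> K \<Longrightarrow> c k = 0"
  shows "card K \<le> order l (char_poly A)"
proof (rule card_le_order[OF K, of "\<lambda>k v. h k (part v)"])
  fix k w j assume "k \<in> K" "w \<in> V" "j \<le> d" "j \<noteq> part w"
  then show "frame_op (\<lambda>v. h k (part v)) w j = l * h k (part w) j"
    using eigen[of k "part w" j] by (simp add: frame_op_part part_le)
next
  fix c k
  assume 0: "\<And>w j. w \<in> V \<Longrightarrow> j \<le> d \<Longrightarrow> j \<noteq> part w \<Longrightarrow> (\<Sum>k\<in>K. c k * h k (part w) j) = 0"
    and k: "k \<in> K"
  show "c k = 0"
  proof (rule indep[OF _ k])
    fix i j assume ij: "i \<le> d" "j \<le> d" "i \<noteq> j"
    obtain w where "w \<in> V" "part w = i"
      using part_nonempty[OF ij(1)] .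
    with 0[of w j] ij show "(\<Sum>k\<in>K. c k * h k i j) = 0"
      by simp
  qed
qed

text \<open>The count is the dimension of the space of infinitesimal rigid motions of
  \<open>d\<close>-space. With \<open>s\<close> antisymmetric and row sums
  \<open>(d + 1) * t\<close>, the row sums of \<open>s - t\<close> are \<open>t\<close>, and the
  four terms of the operator cancel.\<close>

lemma order_0_ge: "d * (d + 1) div 2 \<le> order 0 (char_poly A)"
proof -
  define K where "K = (SIGMA b:{..d}. {..<b})"
  have finK: "finite K"
    by (simp add: K_def)
  have cardK: "card K = d * (d + 1) div 2"
    using gauss_sum_nat[of d] by (simp add: K_def atMost_atLeast0)
  define s :: "nat \<times> nat \<Rightarrow> nat \<Rightarrow> nat \<Rightarrow> real" where
    "s = (\<lambda>(b, a) i j. of_bool (i = a) * of_bool (j = b) - of_bool (i = b) * of_bool (j = a))"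
  define t :: "nat \<times> nat \<Rightarrow> nat \<Rightarrow> real" where
    "t = (\<lambda>(b, a) i. (of_bool (i = a) - of_bool (i = b)) / (d + 1))"
  have s_swap: "s k j i = - s k i j" for k i j
    by (cases k) (simp add: s_def mult.commute)
  have "card K \<le> order 0 (char_poly A)"
  proof (rule card_le_order_part[OF finK, of "\<lambda>k i j. s k i j - t k i"])
    fix k i j assume k: "k \<in> K" and ij: "i \<le> d" "j \<le> d" "i \<noteq> j"
    have "(\<Sum>l\<in>{..d} - {i}. s k i l - t k i) = t k i" if i: "i \<le> d" for i
    proof -
      obtain a b where ab: "k = (b, a)" "a < b" "b \<le> d"
        using k by (auto simp: K_def)
      have "(\<Sum>l\<in>{..d} - {i}. s k i l) = of_bool (i = a) - of_bool (i = b)"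
        using ab by (simp add: s_def sum_subtractf sum_distrib_left[symmetric] sum_of_bool_Diff)
      then have "(\<Sum>l\<in>{..d} - {i}. s k i l) = (d + 1) * t k i"
        by (simp add: t_def ab add_nonneg_eq_0_iff)
      then show ?thesis
        using i by (simp add: sum_subtractf algebra_simps)
    qed
    then show "real m / 2 * (s k i j - t k i + (s k j i - t k j) +
        (\<Sum>l\<in>{..d} - {i}. s k i l - t k i) + (\<Sum>l\<in>{..d} - {j}. s k j l - t k j)) =
      0 * (s k i j - t k i)"
      using ij s_swap[of k i j] by simp
  next
    fix c k assume 0: "\<And>i j. i \<le> d \<Longrightarrow> j \<le> d \<Longrightarrow> i \<noteq> j \<Longrightarrow> (\<Sum>k\<in>K. c k * (s k i j - t k i)) = 0"
      and k: "k \<in> K"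
    \<comment> \<open>The combined \<open>s\<close> is antisymmetric and depends only on its first
      index, which makes the combined \<open>t\<close> alternate in sign and so vanish.\<close>
    have eq: "(\<Sum>k\<in>K. c k * s k i j) = (\<Sum>k\<in>K. c k * t k i)" if "i \<le> d" "j \<le> d" "i \<noteq> j" for i j
      using 0[OF that] by (simp add: right_diff_distrib sum_subtractf)
    have neg: "(\<Sum>k\<in>K. c k * s k j i) = - (\<Sum>k\<in>K. c k * s k i j)" for i j
      by (simp add: s_swap[of _ i j] sum_negf)
    have zero: "(\<Sum>k\<in>K. c k * t k i) = 0" if "i \<le> d" for i
    proof (rule triangle_alternating_zero[OF d _ that])
      fix i j assume "i \<le> d" "j \<le> d" "i \<noteq> j"
      then show "(\<Sum>k\<in>K. c k * t k i) = - (\<Sum>k\<in>K. c k * t k j)"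
        using eq[of i j] eq[of j i] neg[of j i] by simp
    qed
    obtain a b where ab: "k = (b, a)" "a < b" "b \<le> d"
      using k by (auto simp: K_def)
    have "s (b', a') a b = of_bool ((b', a') = (b, a))" if "a' < b'" for a' b'
    proof -
      \<comment> \<open>The negative term would need \<open>b' = a\<close> and
        \<open>a' = b\<close>, against \<open>a' < b'\<close> and \<open>a < b\<close>.\<close>
      have "of_bool (a = b') * of_bool (b = a') = (0 :: real)"
        using ab that by simp
      then show ?thesis
        by (auto simp: s_def)
    qed
    then have "s k' a b = of_bool (k' = k)" if "k' \<in> K" for k'
      using that ab by (auto simp: K_def)
    then have "(\<Sum>k\<in>K. c k * s k a b) = c k"
      using k by (intro sum_mult_single finK) auto
    then show "c k = 0"
      using eq[of a b] zero[of a] ab by simp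
  qed
  then show ?thesis
    by (simp add: cardK)
qed

text \<open>The eigenvectors are edge weightings of the complete graph on the simplex vertices with
  vanishing vertex sums: the edges outside the star of \<open>0\<close> and the triangle \<open>{0, 1, 2}\<close> are free,
  the star corrects the sums at the other vertices, and the triangle corrects the sum at \<open>0\<close>.\<close>

lemma order_one_part: "(d - 2) * (d + 1) div 2 \<le> order (real m) (char_poly A)"
proof -
  define K where "K = (SIGMA b:{..d}. {1..<b}) - {(2, 1)}"
  have finK: "finite K"
    by (simp add: K_def)
  have "card (SIGMA b:{..d}. {1..<b}) = d * (d - 1) div 2"
  proof -
    \<comment> \<open>At \<open>b = 0\<close> the truncated difference is 0, as is the number of
      elements of \<open>{1..<b}\<close>.\<close>
    have "2 * (\<Sum>b\<le>d. b - 1) = d * (d - 1)" for d :: nat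
      by (induction d) (auto simp: algebra_simps diff_mult_distrib2 split: nat_diff_split)
    from this[of d] show ?thesis
      by simp
  qed
  then have "card K = d * (d - 1) div 2 - 1"
    using d by (simp add: K_def card_Diff_singleton)
  moreover have "d * (d - 1) = (d - 2) * (d + 1) + 2"
    using d by (auto simp: le_iff_add algebra_simps)
  ultimately have cardK: "card K = (d - 2) * (d + 1) div 2"
    by simp
  define s :: "nat \<Rightarrow> nat \<Rightarrow> nat \<Rightarrow> nat \<Rightarrow> real" where
    "s a b i j = of_bool (i = a) * of_bool (j = b) + of_bool (i = b) * of_bool (j = a)" for a b i j
  have s_swap: "s a b j i = s a b i j" for a b i j
    by (simp add: s_def mult.commute add.commute)
  have s_row: "(\<Sum>l\<in>{..d} - {i}. s a b i l) = of_bool (i = a) + of_bool (i = b)"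
    if "a \<noteq> b" "a \<le> d" "b \<le> d" for a b i
    using that by (simp add: s_def sum.distrib sum_distrib_left[symmetric] sum_of_bool_Diff)
  \<comment> \<open>The signs balance at every vertex: at 0 they are two minus and two plus, at 1
    and 2 the last three terms cancel. For \<open>(b, a) = (2, 1)\<close> the formula collapses to
    zero, which is why \<open>K\<close> omits that pair.\<close>
  define h where "h = (\<lambda>(b, a) i j. s a b i j - s 0 a i j - s 0 b i j + s 0 1 i j + s 0 2 i j - s 1 2 i j)"
  have "card K \<le> order (real m) (char_poly A)"
  proof (rule card_le_order_part[OF finK, of h])
    fix k i j assume k: "k \<in> K" and ij: "i \<le> d" "j \<le> d" "i \<noteq> j"
    obtain a b where ab: "k = (b, a)" "1 \<le> a" "a < b" "b \<le> d"
      using k by (auto simp: K_def)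
    have "(\<Sum>l\<in>{..d} - {i}. h k i l) = 0" for i
      using ab d by (simp add: h_def sum.distrib sum_subtractf s_row)
    moreover have "h k j i = h k i j"
      by (simp add: h_def ab s_swap[of _ _ i j])
    ultimately show "real m / 2 * (h k i j + h k j i + (\<Sum>l\<in>{..d} - {i}. h k i l) +
        (\<Sum>l\<in>{..d} - {j}. h k j l)) = real m * h k i j"
      by simp
  next
    fix c k assume 0: "\<And>i j. i \<le> d \<Longrightarrow> j \<le> d \<Longrightarrow> i \<noteq> j \<Longrightarrow> (\<Sum>k\<in>K. c k * h k i j) = 0"
      and k: "k \<in> K"
    obtain a b where kab: "k = (b, a)"
      by (cases k)
    then have ab: "1 \<le> a" "a < b" "b \<le> d" "(b, a) \<noteq> (2, 1)"
      using k by (auto simp: K_def)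
    \<comment> \<open>The edge \<open>{a, b}\<close> avoids 0 and is not \<open>{1, 2}\<close>, so
      all correction terms vanish there.\<close>
    have "h (b', a') a b = of_bool ((b', a') = (b, a))" if "a' < b'" for a' b'
      using ab that by (auto simp: h_def s_def)
    then have "h k' a b = of_bool (k' = k)" if "k' \<in> K" for k'
      using that kab by (auto simp: K_def)
    then have "(\<Sum>k\<in>K. c k * h k a b) = c k"
      using k by (intro sum_mult_single finK) auto
    then show "c k = 0"
      using 0[of a b] ab by simp
  qed
  then show ?thesis
    by (simp add: cardK)
qed

end

section \<open>Geometry of the regular simplex\<close>

text \<open>Positivity comes from affine independence: side length 0 would make vertices 0 and 1
  coincide, and the coefficients 1 and -1 on them would be a nontrivial affine relation.\<close>

lemma regular_simplex_side:
  fixes s :: "nat \<Rightarrow> real vec"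
  assumes s: "regular_simplex d s" and d: "1 \<le> d"
  obtains a where "0 < a"
    and "\<And>i j. i \<le> d \<Longrightarrow> j \<le> d \<Longrightarrow> i \<noteq> j \<Longrightarrow> vec_len (s i - s j) = a"
    and "\<And>i j. i \<le> d \<Longrightarrow> j \<le> d \<Longrightarrow> i \<noteq> j \<Longrightarrow> (\<Sum>c<d. (s i $ c - s j $ c)\<^sup>2) = a\<^sup>2"
proof -
  have carrier: "s i \<in> carrier_vec d" if "i \<le> d" for i
    using s that by (auto simp: regular_simplex_def)
  have affine: "i \<le> d \<Longrightarrow> c i = 0"
    if "(\<Sum>i\<le>d. c i) = 0" "\<And>k. k < d \<Longrightarrow> (\<Sum>i\<le>d. c i * s i $ k) = 0" for c :: "nat \<Rightarrow> real" and i
    using s that unfolding regular_simplex_def by blast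
  obtain a where a: "\<And>i j. i \<le> d \<Longrightarrow> j \<le> d \<Longrightarrow> i \<noteq> j \<Longrightarrow> vec_len (s i - s j) = a"
    using s by (auto simp: regular_simplex_def)
  have vec_len: "vec_len (s i - s j) = sqrt (\<Sum>c<d. (s i $ c - s j $ c)\<^sup>2)" if "i \<le> d" "j \<le> d" for i j
    using carrier[OF that(1)] carrier[OF that(2)]
    by (simp add: vec_len_def scalar_prod_def power2_eq_square lessThan_atLeast0)
  have sq: "(\<Sum>c<d. (s i $ c - s j $ c)\<^sup>2) = a\<^sup>2" if "i \<le> d" "j \<le> d" "i \<noteq> j" for i j
    using a[OF that] vec_len[OF that(1,2)] by (auto simp: sum_nonneg)
  have "0 \<le> a"
    using a[of 0 1] vec_len[of 0 1] d by (simp add: sum_nonneg)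
  moreover have "a \<noteq> 0"
  proof
    assume "a = 0"
    then have "(\<Sum>c<d. (s 0 $ c - s 1 $ c)\<^sup>2) = 0"
      using sq[of 0 1] d by simp
    then have eq: "s 0 $ c = s 1 $ c" if "c < d" for c
      using that by (simp add: sum_nonneg_eq_0_iff)
    define f :: "nat \<Rightarrow> real" where "f i = of_bool (i = 0) - of_bool (i = 1)" for i
    have f: "(\<Sum>i\<le>d. f i * g i) = g 0 - g 1" for g
    proof -
      have "(\<Sum>i\<le>d. f i * g i) = (\<Sum>i\<le>d. (if i = 0 then g i else 0) - (if i = 1 then g i else 0))"
        by (intro sum.cong) (auto simp: f_def)
      also have "\<dots> = g 0 - g 1"
        using d by (simp add: sum_subtractf)
      finally show ?thesis .
    qed
    have "f 0 = 0"
    proof (rule affine)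
      show "(\<Sum>i\<le>d. f i) = 0"
        using f[of "\<lambda>_. 1"] by simp
      show "(\<Sum>i\<le>d. f i * s i $ k) = 0" if "k < d" for k
        using f[of "\<lambda>i. s i $ k"] eq[OF that] by simp
    qed simp
    then show False
      by (simp add: f_def)
  qed
  ultimately show thesis
    using that[of a] a sq by simp
qed

text \<open>This is the law of cosines at the corner \<open>x\<close>; it supplies the inner product
  1/2 in an equilateral triangle of side 1.\<close>

lemma inner_diff_polarization:
  fixes x y z :: "'i \<Rightarrow> real"
  shows "(\<Sum>c\<in>C. (x c - y c) * (x c - z c)) =
    ((\<Sum>c\<in>C. (x c - y c)\<^sup>2) + (\<Sum>c\<in>C. (x c - z c)\<^sup>2) - (\<Sum>c\<in>C. (y c - z c)\<^sup>2)) / 2"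
  unfolding sum.distrib[symmetric] sum_subtractf[symmetric] sum_divide_distrib
  by (intro sum.cong refl) (simp add: power2_eq_square field_simps)

section \<open>Assembly of the spectrum\<close>

theorem theorem1p3:
  fixes d n :: nat
    and P :: "nat \<Rightarrow> 'v set" and V :: "'v set" and E :: "'v set set"
    and s :: "nat \<Rightarrow> real vec" and q :: "'v \<Rightarrow> real vec"
    and vs :: "'v list" and es :: "('v \<times> 'v) list"
  assumes "2 \<le> d" and "d + 1 \<le> n" and "(d + 1) dvd n"
    and "complete_balanced_multipartite n (d + 1) P V E"
    and "enumerates_graph V E vs es"
    and "regular_simplex d s"
    and "\<And>i v. i < d + 1 \<Longrightarrow> v \<in> P i \<Longrightarrow> q v = s i"
  shows "spectrum_mset (stiffness_matrix d vs es q) =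
      replicate_mset (d * (d + 1) div 2) 0
    + replicate_mset ((n - d - 1) * (d - 1)) (real n / (2 * (real d + 1)))
    + replicate_mset ((d - 2) * (d + 1) div 2) (real n / (real d + 1))
    + replicate_mset (n - 1) (real n / 2)
    + replicate_mset 1 (real n)"
proof -
  note d = assms(1) and graph = assms(5) and q = assms(7)
  obtain m where n: "n = m * (d + 1)"
    using assms(3) by (metis dvdE mult.commute)
  have m: "0 < m"
    using assms(2) n by (cases m) auto
  have disj: "disjoint_family_on P {..<d + 1}"
    and P: "\<And>i. i \<le> d \<Longrightarrow> card (P i) = m"
    and V: "V = (\<Union>i<d + 1. P i)"
    and E: "E = {{u, v} | u v i j. i < d + 1 \<and> j < d + 1 \<and> i \<noteq> j \<and> u \<in> P i \<and> v \<in> P j}"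
    using assms(4) n by (auto simp: complete_balanced_multipartite_def simp del: mult_Suc_right)
  define part where "part v = (SOME i. i \<le> d \<and> v \<in> P i)" for v
  have part: "part v \<le> d \<and> v \<in> P (part v)" if "v \<in> V" for v
    unfolding part_def using that by (intro someI_ex[of "\<lambda>i. i \<le> d \<and> v \<in> P i"]) (auto simp: V less_Suc_eq_le)
  have part_unique: "part v = i" if "i \<le> d" "v \<in> P i" for v i
  proof -
    have "v \<in> V"
      using that by (auto simp: V less_Suc_eq_le)
    then have "v \<in> P (part v) \<inter> P i" "part v \<in> {..<d + 1}" "i \<in> {..<d + 1}"
      using part[of v] that by auto
    then show ?thesis
      using disj unfolding disjoint_family_on_def by blast
  qed
  have part_set: "{v \<in> V. part v = i} = P i" if "i \<le> d" for i
    using that part part_unique by (auto simp: V less_Suc_eq_le)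
  have edge_iff: "{u, v} \<in> E \<longleftrightarrow> u \<in> V \<and> v \<in> V \<and> part u \<noteq> part v" for u v
  proof
    assume "{u, v} \<in> E"
    then obtain i j where "i \<le> d" "j \<le> d" "i \<noteq> j" "u \<in> P i \<and> v \<in> P j \<or> v \<in> P i \<and> u \<in> P j"
      by (auto simp: E doubleton_eq_iff less_Suc_eq_le)
    then show "u \<in> V \<and> v \<in> V \<and> part u \<noteq> part v"
      using part_unique by (auto simp: V less_Suc_eq_le)
  next
    assume "u \<in> V \<and> v \<in> V \<and> part u \<noteq> part v"
    then have "part u < d + 1" "part v < d + 1" "u \<in> P (part u)" "v \<in> P (part v)" "part u \<noteq> part v"
      using part[of u] part[of v] by auto
    then show "{u, v} \<in> E"
      unfolding E by blast
  qed
  have qs: "q v = s (part v)" if "v \<in> V" for v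
    using part[OF that] by (intro q) auto
  have s: "s i \<in> carrier_vec d" if "i \<le> d" for i
    using assms(6) that by (auto simp: regular_simplex_def)
  obtain a where a: "0 < a"
    and side: "\<And>i j. i \<le> d \<Longrightarrow> j \<le> d \<Longrightarrow> i \<noteq> j \<Longrightarrow> vec_len (s i - s j) = a"
    and sq: "\<And>i j. i \<le> d \<Longrightarrow> j \<le> d \<Longrightarrow> i \<noteq> j \<Longrightarrow> (\<Sum>c<d. (s i $ c - s j $ c)\<^sup>2) = a\<^sup>2"
    using regular_simplex_side[OF assms(6)] d by auto
  define D where "D i j c = (s i $ c - s j $ c) / a" for i j c
  have dir: "edge_dir d q w v $ c = D (part w) (part v) c"
    if "w \<in> V" "v \<in> V" "part w \<noteq> part v" "c < d" for w v c
  proof -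
    have le: "part w \<le> d" "part v \<le> d"
      using part that by auto
    have "s (part w) \<noteq> s (part v)"
    proof
      assume "s (part w) = s (part v)"
      then have "(\<Sum>c<d. (s (part w) $ c - s (part v) $ c)\<^sup>2) = 0"
        by simp
      then show False
        using sq[OF le that(3)] a by simp
    qed
    then show ?thesis
      using that s[OF le(1)] s[OF le(2)] side[OF le that(3)] by (simp add: edge_dir_def qs D_def)
  qed
  let ?A = "stiffness_matrix d vs es q"
  interpret simplex_multipartite d m V part D vs ?A
  proof
    show "distinct vs" "set vs = V"
      using graph by (auto simp: enumerates_graph_def)
    show "card {v \<in> V. part v = i} = m" if "i \<le> d" for i
      using P[OF that] part_set[OF that] by simp
    show "D j i c = - D i j c" for i j c
      by (simp add: D_def diff_divide_distrib)
    show "(\<Sum>c<d. D i j c * D i k c) = (if j = k then 1 else 1 / 2)"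
      if "i \<le> d" "j \<le> d" "k \<le> d" "j \<noteq> i" "k \<noteq> i" for i j k
    proof -
      have "(\<Sum>c<d. D i j c * D i k c) = (\<Sum>c<d. (s i $ c - s j $ c) * (s i $ c - s k $ c)) / a\<^sup>2"
        by (simp add: D_def sum_divide_distrib power2_eq_square)
      also have "\<dots> = (a\<^sup>2 + a\<^sup>2 - (if j = k then 0 else a\<^sup>2)) / 2 / a\<^sup>2"
        unfolding inner_diff_polarization using that sq[of i j] sq[of i k] sq[of j k] by simp
      also have "\<dots> = (if j = k then 1 else 1 / 2)"
        using a by simp
      finally show ?thesis .
    qed
    fix x y
    assume y: "\<And>w c. w \<in> V \<Longrightarrow> c < d \<Longrightarrow> y w c = (\<Sum>v | v \<in> V \<and> part v \<noteq> part w.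
      D (part w) (part v) c * (\<Sum>b<d. D (part w) (part v) b * (x w b - x v b)))"
    show "?A *\<^sub>v field_vec d vs x = field_vec d vs y"
    proof (rule stiffness_matrix_mult_field_vec[OF graph])
      fix w c assume "w \<in> V" "c < d"
      then show "y w c = (\<Sum>v | {w, v} \<in> E. edge_dir d q w v $ c *
          (\<Sum>b<d. edge_dir d q w v $ b * (x w b - x v b)))"
        unfolding y[OF \<open>w \<in> V\<close> \<open>c < d\<close>] by (intro sum.cong) (auto simp: edge_iff dir)
    qed (use edge_iff qs s part in auto)
  qed (use d m part in auto)
  have cardV: "card V = n"
    using card_V n by simp
  define ks where "ks = [(d * (d + 1) div 2, 0), ((n - d - 1) * (d - 1), real m / 2),
    ((d - 2) * (d + 1) div 2, real m), (n - 1, real m * (real d + 1) / 2), (1, real m * (real d + 1))]"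
  have "proots (char_poly ?A) = (\<Sum>(k, l)\<leftarrow>ks. replicate_mset k l)"
  proof (rule proots_eq_sum_replicate)
    have deg: "degree (char_poly ?A) = d * length vs \<and> lead_coeff (char_poly ?A) = 1"
      using degree_monic_char_poly[OF stiffness_matrix_carrier] by metis
    then show "char_poly ?A \<noteq> 0"
      by auto
    \<comment> \<open>Used with \<open>y = m\<close> and \<open>z = m * (d + 1)\<close>; the gap
      \<open>2 * y < z\<close> amounts to \<open>1 < d\<close> and keeps \<open>m\<close> apart from
      \<open>m * (d + 1) / 2\<close>.\<close>
    have "distinct [0, y / 2, y, z / 2, z]" if "0 < y" "2 * y < z" for y z :: real
      using that by auto
    moreover have "2 * real m < real m * (real d + 1)"
      using mult_strict_left_mono[of 2 "real d + 1" "real m"] m d by simp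
    moreover have "0 < real m"
      using m by simp
    ultimately have "distinct [0, real m / 2, real m, real m * (real d + 1) / 2, real m * (real d + 1)]"
      by blast
    then show "distinct (map snd ks)"
      by (simp only: ks_def list.map snd_conv)
    have order_half: "(n - d - 1) * (d - 1) \<le> order (real m / 2) (char_poly ?A)"
      using order_half_parts by (simp add: cardV)
    show "k \<le> order l (char_poly ?A)" if "(k, l) \<in> set ks" for k l
      using that order_0_ge order_half order_one_part order_half_all[unfolded cardV] order_all
      unfolding ks_def list.set by blast
    have "length vs = n"
      using cardV distinct_vs set_vs by (metis distinct_card)
    moreover have "sum_list (map fst ks) = d * n"
    proof -
      \<comment> \<open>Parity removes the two divisions by 2; writing \<open>d\<close> and
        \<open>n\<close> as sums below removes the truncated subtractions.\<close>
      have "even (d * (d + 1))" "even ((d - 2) * (d + 1))"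
        by auto
      then have "2 * sum_list (map fst ks) =
          d * (d + 1) + 2 * ((n - d - 1) * (d - 1)) + (d - 2) * (d + 1) + 2 * n"
        using assms(2) by (simp add: ks_def)
      moreover obtain d' n' where "d = d' + 2" "n = n' + d + 1"
        using d assms(2) by (metis add.assoc add.commute le_Suc_ex)
      ultimately show ?thesis
        by (simp add: algebra_simps)
    qed
    ultimately show "degree (char_poly ?A) = sum_list (map fst ks)"
      using deg by simp
  qed
  moreover have "real m / 2 = real n / (2 * (real d + 1))" "real m = real n / (real d + 1)"
    "real m * (real d + 1) = real n"
    by (simp_all add: n field_simps add_nonneg_eq_0_iff)
  ultimately show ?thesis
    by (simp add: spectrum_mset_def ks_def mult.commute)
qed

end
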